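(* Let $1<p<\infty$ and let $\ell_p^2$ be the real space $\mathbb{R}^2$ endowed with the $p$-norm $\|(x,y)\|_p=(|x|^p+|y|^p)^{1/p}$. (a) If $p$ is an even number and $k\in\mathbb{N}$, then $n^{(k)}(\ell_p^2)=0$ if $k\geq p-1$, and $n^{(k)}(\ell_p^2)>0$ if $k<p-1$. (b) If $p$ is not an even number, then $n^{(k)}(\ell_p^2)>0$ for every $k\in\mathbb{N}$.
   Context: $\mathbb{N}=\{1,2,\dots\}$; "$p$ is an even number" means that $p$ is an even integer. For a Banach space $X$, let $S_X$ be its unit sphere, $B_X$ its closed unit ball, $X^*$ its dual, and $\Pi(X)=\{(x,x^* )\in S_X\times S_{X^*} : x^*(x)=1\}$. A continuous $k$-homogeneous polynomial on $X$ is a map $P:X\to X$ of the form $P(x)=A(x,\ldots,x)$ with $A:X\times\cdots\times X\to X$ a continuous $k$-linear map; $\mathcal{P}(^kX;X)$ is the space of all of them, normed by $\|P\|=\sup\{\|P(x)\| : x\in B_X\}$. The numerical radius of $P$ is $v(P)=\sup\{|x^*(P(x))| : (x,x^* )\in\Pi(X)\}$. The polynomial numerical index of order $k$ of $X$ is $n^{(k)}(X)=\inf\{v(P) : P\in\mathcal{P}(^kX;X),\ \|P\|=1\}$. *)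

theory Defs
  imports "HOL-Analysis.Analysis"
begin

text \<open>A real normed space \<open>X\<close> is given by a real vector space type together with an explicit
  norm \<open>N\<close>, so that the norm may depend on a parameter (here the exponent \<open>p\<close>). The suprema
  below are suprema of reals: they carry their usual meaning because the sets involved are
  nonempty and bounded above for continuous functionals and polynomials on \<open>X \<noteq> {0}\<close>.\<close>

definition norm_topology :: "('a::real_vector \<Rightarrow> real) \<Rightarrow> 'a topology" where
  "norm_topology N = Metric_space.mtopology UNIV (\<lambda>x y. N (x - y))"

definition unit_sphere :: "('a::real_vector \<Rightarrow> real) \<Rightarrow> 'a set" where
  "unit_sphere N = {x. N x = 1}"

definition unit_ball :: "('a::real_vector \<Rightarrow> real) \<Rightarrow> 'a set" where
  "unit_ball N = {x. N x \<le> 1}"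

definition dual_space :: "('a::real_vector \<Rightarrow> real) \<Rightarrow> ('a \<Rightarrow> real) set" where
  "dual_space N = {f. linear f \<and> continuous_map (norm_topology N) euclideanreal f}"

definition dual_norm :: "('a::real_vector \<Rightarrow> real) \<Rightarrow> ('a \<Rightarrow> real) \<Rightarrow> real" where
  "dual_norm N f = (SUP x\<in>unit_ball N. \<bar>f x\<bar>)"

definition dual_unit_sphere :: "('a::real_vector \<Rightarrow> real) \<Rightarrow> ('a \<Rightarrow> real) set" where
  "dual_unit_sphere N = {f \<in> dual_space N. dual_norm N f = 1}"

definition state_pairs :: "('a::real_vector \<Rightarrow> real) \<Rightarrow> ('a \<times> ('a \<Rightarrow> real)) set" where
  "state_pairs N = {(x, f) \<in> unit_sphere N \<times> dual_unit_sphere N. f x = 1}"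

text \<open>The \<open>k\<close>-fold product of \<open>X\<close> is the set of extensional functions on \<open>{..<k}\<close>, which is
  the carrier of the library's product topology; values of \<open>A\<close> elsewhere are irrelevant.\<close>

definition continuous_multilinear ::
    "('a::real_vector \<Rightarrow> real) \<Rightarrow> nat \<Rightarrow> ((nat \<Rightarrow> 'a) \<Rightarrow> 'a) \<Rightarrow> bool" where
  "continuous_multilinear N k A \<longleftrightarrow>
     (\<forall>x \<in> {..<k} \<rightarrow>\<^sub>E UNIV. \<forall>i<k. linear (\<lambda>v. A (x(i := v)))) \<and>
     continuous_map (product_topology (\<lambda>_. norm_topology N) {..<k}) (norm_topology N) A"

definition homogeneous_polynomials ::
    "('a::real_vector \<Rightarrow> real) \<Rightarrow> nat \<Rightarrow> ('a \<Rightarrow> 'a) set" where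
  "homogeneous_polynomials N k =
     {P. \<exists>A. continuous_multilinear N k A \<and> (\<forall>x. P x = A (\<lambda>i\<in>{..<k}. x))}"

definition polynomial_norm :: "('a::real_vector \<Rightarrow> real) \<Rightarrow> ('a \<Rightarrow> 'a) \<Rightarrow> real" where
  "polynomial_norm N P = (SUP x\<in>unit_ball N. N (P x))"

definition numerical_radius :: "('a::real_vector \<Rightarrow> real) \<Rightarrow> ('a \<Rightarrow> 'a) \<Rightarrow> real" where
  "numerical_radius N P = (SUP (x, f)\<in>state_pairs N. \<bar>f (P x)\<bar>)"

definition polynomial_numerical_index :: "('a::real_vector \<Rightarrow> real) \<Rightarrow> nat \<Rightarrow> real" where
  "polynomial_numerical_index N k =
     (INF P\<in>{P \<in> homogeneous_polynomials N k. polynomial_norm N P = 1}. numerical_radius N P)"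

definition lp_norm :: "real \<Rightarrow> real ^ 2 \<Rightarrow> real" where
  "lp_norm p v = (\<bar>v $ 1\<bar> powr p + \<bar>v $ 2\<bar> powr p) powr (1 / p)"

definition even_number :: "real \<Rightarrow> bool" where
  "even_number p \<longleftrightarrow> (\<exists>m::int. even m \<and> p = of_int m)"

end

theory Submission imports Defs "HOL-Computational_Algebra.Polynomial" begin

text \<open>
  At a unit vector \<open>x\<close> the only supporting functional is
  \<open>y \<mapsto> \<Sum>\<^sub>j sgn x\<^sub>j \<bar>x\<^sub>j\<bar>\<^sup>p\<^sup>-\<^sup>1 y\<^sub>j\<close>. Evaluating at multiples of \<open>(1, t)\<close>, a form
  \<open>P = (P\<^sub>1, P\<^sub>2)\<close> has numerical radius zero iff
  \<open>P\<^sub>1(1,t) = - sgn t \<bar>t\<bar>\<^sup>p\<^sup>-\<^sup>1 P\<^sub>2(1,t)\<close> for all \<open>t\<close>. If \<open>P \<noteq> 0\<close>, comparing orders of vanishing at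
  \<open>0\<close> shows that \<open>p - 1\<close> is an integer, comparing the signs of \<open>t\<close> that it is odd, and comparing
  degrees that it is at most \<open>k\<close>. Otherwise the numerical radius has trivial kernel on a
  finite-dimensional space, so compactness of the coefficient sphere bounds it away from zero. In
  the exceptional case \<open>x\<^sub>1\<^sup>k\<^sup>-\<^sup>p\<^sup>+\<^sup>1 (- x\<^sub>2\<^sup>p\<^sup>-\<^sup>1, x\<^sub>1\<^sup>p\<^sup>-\<^sup>1)\<close> has numerical radius zero.
\<close>

section \<open>The norm and its supporting functionals\<close>

text \<open>The formula is taken for every \<open>x\<close>, not just for unit vectors; it is then
  positively homogeneous of degree \<open>p - 1\<close> in \<open>x\<close>, so points (1, t) can be
  used without normalizing them.\<close>

definition support_functional :: "real \<Rightarrow> real ^ 2 \<Rightarrow> real ^ 2 \<Rightarrow> real" where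
  "support_functional p x y =
     sgn (x $ 1) * \<bar>x $ 1\<bar> powr (p - 1) * y $ 1 + sgn (x $ 2) * \<bar>x $ 2\<bar> powr (p - 1) * y $ 2"

context
  fixes p :: real
  assumes p: "1 < p"
begin

lemma lp_norm_nonneg: "0 \<le> lp_norm p v"
  by (simp add: lp_norm_def)

lemma lp_norm_powr: "lp_norm p v powr p = \<bar>v $ 1\<bar> powr p + \<bar>v $ 2\<bar> powr p"
  using p by (simp add: lp_norm_def powr_powr)

lemma lp_norm_scale: "lp_norm p (a *\<^sub>R v) = \<bar>a\<bar> * lp_norm p v"
proof -
  have "lp_norm p (a *\<^sub>R v) = (\<bar>a\<bar> powr p * (\<bar>v $ 1\<bar> powr p + \<bar>v $ 2\<bar> powr p)) powr (1 / p)"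
    by (simp add: lp_norm_def abs_mult powr_mult distrib_left)
  then show ?thesis
    using p by (simp add: powr_mult powr_powr lp_norm_def)
qed

lemma component_le_lp_norm: "\<bar>v $ j\<bar> \<le> lp_norm p v"
proof -
  have "\<bar>v $ j\<bar> powr p \<le> \<bar>v $ 1\<bar> powr p + \<bar>v $ 2\<bar> powr p"
    using exhaust_2[of j] by auto
  then have "(\<bar>v $ j\<bar> powr p) powr (1 / p) \<le> lp_norm p v"
    using p by (auto simp: lp_norm_def intro!: powr_mono2)
  then show ?thesis using p by (simp add: powr_powr)
qed

lemma lp_norm_eq_0_iff: "lp_norm p v = 0 \<longleftrightarrow> v = 0"
proof
  assume "lp_norm p v = 0"
  then have "v $ j = 0" for j using component_le_lp_norm[of v j] by simp
  then show "v = 0" by (simp add: vec_eq_iff)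
qed (use p in \<open>simp add: lp_norm_def\<close>)

lemma lp_norm_normalize: "v \<noteq> 0 \<Longrightarrow> lp_norm p (inverse (lp_norm p v) *\<^sub>R v) = 1"
  using lp_norm_nonneg[of v] lp_norm_eq_0_iff[of v] by (simp add: lp_norm_scale)

lemma linear_support_functional: "linear (support_functional p x)"
  by (rule linearI) (simp_all add: support_functional_def algebra_simps)

text \<open>Young's inequality for the conjugate exponents p/(p-1) and p, applied to
  \<open>a powr (p - 1)\<close> and \<open>b\<close>; raising the first factor to p/(p-1) restores
  \<open>a powr p\<close>.\<close>

lemma Young_power_product:
  fixes a b :: real
  assumes "0 \<le> a" "0 \<le> b"
  shows "a powr (p - 1) * b \<le> (p - 1) / p * a powr p + b powr p / p"
proof -
  have "1 < p / (p - 1)" "1 / (p / (p - 1)) + 1 / p = 1"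
    using p by (simp_all add: field_simps)
  from Youngs_inequality[OF this(1) p this(2), of "a powr (p - 1)" b] assms p
  show ?thesis by (simp add: powr_powr mult.commute)
qed

lemma support_functional_self:
  assumes "lp_norm p x = 1"
  shows "support_functional p x x = 1"
proof -
  have *: "sgn t * \<bar>t\<bar> powr (p - 1) * t = \<bar>t\<bar> powr p" for t :: real
    using p by (cases "t = 0") (simp_all add: powr_diff sgn_real_def)
  show ?thesis
    using assms lp_norm_powr[of x] by (simp add: support_functional_def *)
qed

text \<open>Hoelder's inequality in the normalized case: Young's inequality in each coordinate,
  added up, leaves at most (p-1)/p + 1/p = 1.\<close>

lemma support_functional_le_unit:
  assumes "lp_norm p x = 1" "lp_norm p y \<le> 1"
  shows "\<bar>support_functional p x y\<bar> \<le> 1"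
proof -
  have "\<bar>sgn s * \<bar>s\<bar> powr (p - 1) * t\<bar> \<le> (p - 1) / p * \<bar>s\<bar> powr p + \<bar>t\<bar> powr p / p" for s t :: real
    using Young_power_product[of "\<bar>s\<bar>" "\<bar>t\<bar>"] p by (cases "s = 0") (simp_all add: abs_mult abs_sgn_eq)
  from add_mono[OF this[of "x $ 1" "y $ 1"] this[of "x $ 2" "y $ 2"]]
  have "\<bar>support_functional p x y\<bar> \<le> (p - 1) / p * lp_norm p x powr p + lp_norm p y powr p / p"
    unfolding support_functional_def lp_norm_powr distrib_left add_divide_distrib by linarith
  also have "lp_norm p y powr p \<le> 1"
    using assms(2) p lp_norm_nonneg[of y] by (simp add: powr_le1)
  then have "(p - 1) / p * lp_norm p x powr p + lp_norm p y powr p / p \<le> (p - 1) / p + 1 / p"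
    using assms p by (simp add: divide_right_mono)
  also have "\<dots> = 1" using p by (simp add: field_simps)
  finally show ?thesis .
qed

lemma linear_le_lp_norm:
  assumes "linear f" and "\<And>y. lp_norm p y \<le> 1 \<Longrightarrow> \<bar>f y\<bar> \<le> 1"
  shows "\<bar>f y :: real\<bar> \<le> lp_norm p y"
proof (cases "y = 0")
  case True
  then show ?thesis using linear_0[OF assms(1)] lp_norm_nonneg by simp
next
  case False
  then have pos: "0 < lp_norm p y" using lp_norm_nonneg[of y] lp_norm_eq_0_iff[of y] by simp
  have "\<bar>f (inverse (lp_norm p y) *\<^sub>R y)\<bar> \<le> 1"
    using assms(2) lp_norm_normalize[OF False] by simp
  then show ?thesis
    using pos by (simp add: linear_scale[OF assms(1)] abs_mult field_simps)
qed

lemma support_functional_le: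
  "lp_norm p x = 1 \<Longrightarrow> \<bar>support_functional p x y\<bar> \<le> lp_norm p y"
  by (rule linear_le_lp_norm[OF linear_support_functional]) (rule support_functional_le_unit)

text \<open>Minkowski's inequality follows by testing the sum against its own support functional.\<close>

lemma lp_norm_triangle: "lp_norm p (x + y) \<le> lp_norm p x + lp_norm p y"
proof (cases "x + y = 0")
  case True
  then show ?thesis using lp_norm_nonneg[of x] lp_norm_nonneg[of y] lp_norm_eq_0_iff[of 0] by simp
next
  case False
  define s where "s = lp_norm p (x + y)"
  define z where "z = inverse s *\<^sub>R (x + y)"
  have s: "s > 0" using False lp_norm_nonneg[of "x + y"] lp_norm_eq_0_iff[of "x + y"] by (simp add: s_def)
  have z: "lp_norm p z = 1" using lp_norm_normalize[OF False] by (simp add: z_def s_def)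
  note lin = linear_support_functional[of z]
  have "x + y = s *\<^sub>R z" using s by (simp add: z_def)
  then have "s = support_functional p z (x + y)"
    by (simp add: linear_scale[OF lin] support_functional_self[OF z])
  also have "\<dots> = support_functional p z x + support_functional p z y"
    by (rule linear_add[OF lin])
  also have "\<dots> \<le> lp_norm p x + lp_norm p y"
    using support_functional_le[OF z, of x] support_functional_le[OF z, of y] by linarith
  finally show ?thesis by (simp add: s_def)
qed

lemma lp_norm_sum: "lp_norm p (\<Sum>i\<in>I. f i) \<le> (\<Sum>i\<in>I. lp_norm p (f i))"
proof (induction I rule: infinite_finite_induct)
  case (insert i I)
  then show ?case using lp_norm_triangle[of "f i" "\<Sum>i\<in>I. f i"] by simp
qed (simp_all add: lp_norm_eq_0_iff[THEN iffD2])

lemma lp_norm_minus_commute: "lp_norm p (x - y) = lp_norm p (y - x)"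
  using lp_norm_scale[of "-1" "x - y"] by simp

text \<open>Together with \<open>norm_le_lp_norm\<close> this makes the p-norm equivalent to the
  Euclidean norm. The crude constant 2 suffices to identify the topologies.\<close>

lemma lp_norm_le_norm: "lp_norm p v \<le> 2 * norm v"
proof -
  have "v = (v $ 1) *\<^sub>R axis 1 1 + (v $ 2) *\<^sub>R axis 2 1"
    by (simp add: vec_eq_iff forall_2 axis_def)
  then have "lp_norm p v \<le> lp_norm p ((v $ 1) *\<^sub>R axis 1 1) + lp_norm p ((v $ 2) *\<^sub>R axis 2 1)"
    by (metis lp_norm_triangle)
  also have "\<dots> = \<bar>v $ 1\<bar> + \<bar>v $ 2\<bar>"
    using p by (simp add: lp_norm_scale) (simp add: lp_norm_def axis_def)
  also have "\<dots> \<le> 2 * norm v"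
    using component_le_norm_cart[of v 1] component_le_norm_cart[of v 2] by simp
  finally show ?thesis .
qed

lemma norm_le_lp_norm: "norm v \<le> 2 * lp_norm p v"
  using norm_le_l1_cart[of v] component_le_lp_norm[of v 1] component_le_lp_norm[of v 2]
  by (simp add: sum_2)

section \<open>Topology, dual space and unit ball of the p-norm\<close>

lemma Metric_space_lp_norm: "Metric_space UNIV (\<lambda>x y. lp_norm p (x - y))"
proof
  show "lp_norm p (x - z) \<le> lp_norm p (x - y) + lp_norm p (y - z)" for x y z
    using lp_norm_triangle[of "x - y" "y - z"] by simp
qed (simp_all add: lp_norm_nonneg lp_norm_eq_0_iff lp_norm_minus_commute)

lemma norm_topology_lp_norm: "norm_topology (lp_norm p) = euclidean"
proof -
  interpret Metric_space UNIV "\<lambda>x y. lp_norm p (x - y)" by (rule Metric_space_lp_norm)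
  have "openin mtopology U \<longleftrightarrow> open U" for U
  proof
    assume "openin mtopology U"
    then have U: "\<exists>r>0. mball x r \<subseteq> U" if "x \<in> U" for x using that by (auto simp: openin_mtopology)
    show "open U" unfolding open_dist
    proof
      fix x assume "x \<in> U"
      then obtain r where r: "r > 0" "mball x r \<subseteq> U" using U by blast
      \<comment> \<open>Halving the radius absorbs the constant 2 of the norm comparison; the
        converse inclusion does the same.\<close>
      have "y \<in> U" if "dist y x < r / 2" for y
        using r that lp_norm_le_norm[of "x - y"] by (auto simp: dist_norm norm_minus_commute subset_iff)
      then show "\<exists>e>0. \<forall>y. dist y x < e \<longrightarrow> y \<in> U" using r(1) by (intro exI[of _ "r / 2"]) auto
    qed
  next
    assume U: "open U"
    have "\<exists>r>0. mball x r \<subseteq> U" if x: "x \<in> U" for x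
    proof -
      obtain e where e: "e > 0" "\<And>y. dist y x < e \<Longrightarrow> y \<in> U" using U x unfolding open_dist by blast
      have "y \<in> U" if "lp_norm p (x - y) < e / 2" for y
        using that norm_le_lp_norm[of "x - y"] by (intro e(2)) (simp add: dist_norm norm_minus_commute)
      then show ?thesis using e(1) by (intro exI[of _ "e / 2"]) auto
    qed
    then show "openin mtopology U" by (auto simp: openin_mtopology)
  qed
  then show ?thesis by (simp add: norm_topology_def topology_eq)
qed

lemma dual_space_lp_norm: "dual_space (lp_norm p) = {f. linear f}"
  by (auto simp: dual_space_def norm_topology_lp_norm linear_continuous_on linear_conv_bounded_linear)

lemma continuous_on_lp_norm: "continuous_on S (lp_norm p)"
  unfolding lp_norm_def using p by (intro continuous_intros continuous_on_powr') auto

lemma bounded_unit_ball: "bounded (unit_ball (lp_norm p))"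
  unfolding bounded_iff unit_ball_def
proof (intro exI[of _ 2] ballI)
  show "norm x \<le> 2" if "x \<in> {x. lp_norm p x \<le> 1}" for x
    using norm_le_lp_norm[of x] that by simp
qed

lemma compact_unit_ball: "compact (unit_ball (lp_norm p))"
proof -
  have "closed (unit_ball (lp_norm p))"
    unfolding unit_ball_def by (intro closed_Collect_le continuous_on_lp_norm continuous_intros)
  then show ?thesis using bounded_unit_ball by (simp add: compact_eq_bounded_closed)
qed

lemma bdd_above_unit_ball:
  assumes "continuous_on UNIV (f :: real ^ 2 \<Rightarrow> real)"
  shows "bdd_above (f ` unit_ball (lp_norm p))"
  using compact_continuous_image[OF continuous_on_subset[OF assms subset_UNIV] compact_unit_ball]
  by (simp add: bounded_imp_bdd_above compact_imp_bounded)

section \<open>State pairs\<close>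

lemma state_pair_bound:
  assumes "(x, f) \<in> state_pairs (lp_norm p)"
  shows "\<bar>f y\<bar> \<le> lp_norm p y"
proof (rule linear_le_lp_norm)
  show f: "linear f"
    using assms by (auto simp: state_pairs_def dual_unit_sphere_def dual_space_lp_norm)
  have n: "dual_norm (lp_norm p) f = 1" using assms by (auto simp: state_pairs_def dual_unit_sphere_def)
  fix y assume y: "lp_norm p y \<le> 1"
  \<comment> \<open>Continuity bounds the values on the compact unit ball, so the real supremum
    \<open>dual_norm\<close> really dominates them.\<close>
  have "continuous_on UNIV (\<lambda>x. \<bar>f x\<bar>)"
    using f by (intro continuous_intros linear_continuous_on) (simp add: linear_conv_bounded_linear)
  from cSUP_upper[OF _ bdd_above_unit_ball[OF this]] y n
  show "\<bar>f y\<bar> \<le> 1" by (simp add: dual_norm_def unit_ball_def)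
qed

text \<open>The bound 1 on the dual norm is attained at \<open>x\<close> itself.\<close>

lemma support_functional_state_pair:
  assumes "lp_norm p x = 1"
  shows "(x, support_functional p x) \<in> state_pairs (lp_norm p)"
proof -
  have "dual_norm (lp_norm p) (support_functional p x) = 1"
    unfolding dual_norm_def
  proof (rule cSup_eq_maximum)
    show "1 \<in> (\<lambda>y. \<bar>support_functional p x y\<bar>) ` unit_ball (lp_norm p)"
      using assms support_functional_self[OF assms] by (intro image_eqI[of _ _ x]) (auto simp: unit_ball_def)
  qed (use assms support_functional_le_unit in \<open>auto simp: unit_ball_def\<close>)
  then show ?thesis
    using assms support_functional_self[OF assms] linear_support_functional
    by (simp add: state_pairs_def unit_sphere_def dual_unit_sphere_def dual_space_lp_norm)
qed

end

section \<open>Polynomials related by a real power\<close>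

text \<open>Orders of vanishing at 0 must agree on both sides, so \<open>r\<close> is the order of
  \<open>f\<close> minus the order of \<open>g\<close>.\<close>

lemma powr_quotient_of_polynomials:
  fixes f g :: "real poly"
  assumes "g \<noteq> 0" and eq: "\<And>t. t > 0 \<Longrightarrow> poly f t = - (t powr r * poly g t)"
  shows "\<exists>a b. r = real a - real b"
proof -
  have "f \<noteq> 0"
  proof
    assume "f = 0"
    \<comment> \<open>Otherwise \<open>g\<close> would have infinitely many roots.\<close>
    then have "{0<..1} \<subseteq> {t. poly g t = 0}" using eq by auto
    then show False using poly_roots_finite[OF \<open>g \<noteq> 0\<close>] finite_subset infinite_Ioc[of 0 "1::real"] zero_less_one by metis
  qed
  define a b where "a = order 0 f" and "b = order 0 g"
  obtain u where u: "f = [:0, 1:] ^ a * u" "\<not> [:0, 1:] dvd u"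
    using order_decomp[OF \<open>f \<noteq> 0\<close>, of 0] by (auto simp: a_def)
  obtain w where w: "g = [:0, 1:] ^ b * w" "\<not> [:0, 1:] dvd w"
    using order_decomp[OF \<open>g \<noteq> 0\<close>, of 0] by (auto simp: b_def)
  have u0: "poly u 0 \<noteq> 0" and w0: "poly w 0 \<noteq> 0"
    using u(2) w(2) poly_eq_0_iff_dvd[of _ 0] by auto
  \<comment> \<open>The exponent left over after the powers of t are split off. As \<open>u\<close>
    and \<open>w\<close> do not vanish at 0, letting t tend to 0 from the right forces
    \<open>e\<close> to be 0.\<close>
  define e where "e = r + real b - real a"
  have lim: "((\<lambda>t. poly h t) \<longlongrightarrow> poly h 0) (at_right 0)" for h :: "real poly"
    by (intro tendsto_intros)
  have lim0: "((\<lambda>t. t powr s) \<longlongrightarrow> 0) (at_right (0::real))" if "s > 0" for s :: real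
    using that by real_asymp
  have eq': "poly u t = - (t powr e * poly w t)" if "t > 0" for t
  proof -
    have "t powr real a * poly u t = - (t powr r * t powr real b * poly w t)"
      using eq[OF that] that by (simp add: u(1) w(1) powr_realpow mult_ac)
    then show ?thesis
      using that by (simp add: e_def powr_add powr_diff field_simps)
  qed
  have "\<not> e > 0"
  proof
    assume "e > 0"
    have "((\<lambda>t. - (t powr e * poly w t)) \<longlongrightarrow> - (0 * poly w 0)) (at_right 0)"
      by (intro tendsto_intros lim0 \<open>e > 0\<close> lim)
    moreover have "\<forall>\<^sub>F t in at_right 0. - (t powr e * poly w t) = poly u t"
      by (simp add: eventually_at_filter eq')
    ultimately have "(poly u \<longlongrightarrow> 0) (at_right 0)"
      using Lim_transform_eventually by fastforce
    then show False using tendsto_unique[OF _ lim[of u]] u0 by force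
  qed
  moreover have "\<not> e < 0"
  proof
    assume "e < 0"
    \<comment> \<open>For negative \<open>e\<close> the roles are exchanged: solving for
      \<open>w\<close> turns the exponent positive, and now \<open>w\<close> would vanish at
      0.\<close>
    have *: "poly w t = - (t powr (- e) * poly u t)" if "t > 0" for t
      using eq'[OF that] that by (simp add: powr_minus field_simps)
    have "((\<lambda>t. - (t powr (-e) * poly u t)) \<longlongrightarrow> - (0 * poly u 0)) (at_right 0)"
      using \<open>e < 0\<close> by (intro tendsto_intros lim0 lim) auto
    moreover have "\<forall>\<^sub>F t in at_right 0. - (t powr (-e) * poly u t) = poly w t"
      by (simp add: eventually_at_filter *)
    ultimately have "(poly w \<longlongrightarrow> 0) (at_right 0)"
      using Lim_transform_eventually by fastforce
    then show False using tendsto_unique[OF _ lim[of w]] w0 by force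
  qed
  ultimately have "r = real a - real b" by (simp add: e_def)
  then show ?thesis by blast
qed

lemma poly_eq_if_eq_on_pos:
  fixes f g :: "real poly"
  assumes "\<And>t. t > 0 \<Longrightarrow> poly f t = poly g t"
  shows "f = g"
proof (rule ccontr)
  assume "f \<noteq> g"
  then have "finite {t. poly (f - g) t = 0}" by (intro poly_roots_finite) simp
  moreover have "{0<..(1::real)} \<subseteq> {t. poly (f - g) t = 0}" using assms by auto
  ultimately show False using finite_subset infinite_Ioc[of 0 "1::real"] zero_less_one by metis
qed

lemma powr_polynomial_relation:
  fixes f g :: "real poly"
  assumes "0 < r" "g \<noteq> 0"
    and pos: "\<And>t. t > 0 \<Longrightarrow> poly f t = - (t powr r * poly g t)"
    and neg: "\<And>t. t > 0 \<Longrightarrow> poly f (- t) = t powr r * poly g (- t)"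
  shows "\<exists>m. r = real m \<and> odd m \<and> m \<le> degree f"
proof -
  obtain a b where ab: "r = real a - real b"
    using powr_quotient_of_polynomials[OF \<open>g \<noteq> 0\<close> pos] by blast
  \<comment> \<open>Truncated subtraction is harmless here because \<open>r\<close> is positive, so
    a > b.\<close>
  define m where "m = a - b"
  have m: "r = real m" using ab \<open>0 < r\<close> by (simp add: m_def)
  have f: "f = - (monom 1 m * g)"
    by (rule poly_eq_if_eq_on_pos) (simp add: pos m powr_realpow poly_monom)
  have "odd m"
  proof
    assume "even m"
    \<comment> \<open>For even \<open>m\<close> the identity f = -X^m g, read at -t, has the
      opposite sign to \<open>neg\<close>; hence g(-t) = 0 for all t > 0.\<close>
    have "pcompose g [:0, -1:] = 0"
    proof (rule poly_eq_if_eq_on_pos)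
      fix t :: real assume t: "t > 0"
      have "- (t ^ m * poly g (- t)) = t ^ m * poly g (- t)"
        using neg[OF t] t \<open>even m\<close> by (simp add: f m powr_realpow poly_monom)
      then show "poly (pcompose g [:0, -1:]) t = poly 0 t" using t by (simp add: poly_pcompose)
    qed
    then show False using \<open>g \<noteq> 0\<close> by (simp add: pcompose_eq_0_iff)
  qed
  moreover have "m \<le> degree f"
    using \<open>g \<noteq> 0\<close> by (simp add: f degree_mult_eq degree_monom_eq monom_eq_0_iff)
  ultimately show ?thesis using m by blast
qed

section \<open>Homogeneous polynomials as binary forms\<close>

text \<open>The coefficients are vectors, so one family describes both components. Indexing them by
  all naturals places them in a function space with the product topology, where compactness is used
  later.\<close>

definition binary_form :: "nat \<Rightarrow> (nat \<Rightarrow> real ^ 2) \<Rightarrow> real ^ 2 \<Rightarrow> real ^ 2" where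
  "binary_form k c x = (\<Sum>i\<le>k. (x $ 1 ^ (k - i) * x $ 2 ^ i) *\<^sub>R c i)"

lemma binary_form_nth:
  "binary_form k c x $ j = (\<Sum>i\<le>k. x $ 1 ^ (k - i) * x $ 2 ^ i * c i $ j)"
  by (simp add: binary_form_def sum_component)

lemma binary_form_Suc:
  "\<exists>e. \<forall>x. x $ 1 *\<^sub>R binary_form k c x + x $ 2 *\<^sub>R binary_form k d x = binary_form (Suc k) e x"
proof (intro exI allI)
  fix x
  \<comment> \<open>Multiplying by the first coordinate keeps the exponent of the second,
    multiplying by the second raises it by one; hence the shift in \<open>d\<close>. The guards
    supply zeros at the two ends.\<close>
  define e where "e i = (if i \<le> k then c i else 0) + (if i = 0 then 0 else d (i - 1))" for i
  have "binary_form (Suc k) e x =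
      (\<Sum>i\<le>Suc k. (x $ 1 ^ (Suc k - i) * x $ 2 ^ i) *\<^sub>R (if i \<le> k then c i else 0)) +
      (\<Sum>i\<le>Suc k. (x $ 1 ^ (Suc k - i) * x $ 2 ^ i) *\<^sub>R (if i = 0 then 0 else d (i - 1)))"
    by (simp only: binary_form_def e_def scaleR_add_right sum.distrib)
  also have "(\<Sum>i\<le>Suc k. (x $ 1 ^ (Suc k - i) * x $ 2 ^ i) *\<^sub>R (if i \<le> k then c i else 0)) =
      x $ 1 *\<^sub>R binary_form k c x"
    by (simp add: binary_form_def scaleR_sum_right Suc_diff_le mult.assoc)
  also have "(\<Sum>i\<le>Suc k. (x $ 1 ^ (Suc k - i) * x $ 2 ^ i) *\<^sub>R (if i = 0 then 0 else d (i - 1))) =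
      x $ 2 *\<^sub>R binary_form k d x"
    unfolding sum.atMost_Suc_shift by (simp add: binary_form_def scaleR_sum_right mult_ac)
  finally show "x $ 1 *\<^sub>R binary_form k c x + x $ 2 *\<^sub>R binary_form k d x = binary_form (Suc k) e x"
    by simp
qed

text \<open>Induction on the number \<open>j\<close> of slots holding the variable \<open>x\<close>,
  the other slots being frozen at \<open>u\<close>. Expanding slot \<open>j\<close> in the standard
  basis gives two instances with fewer variable slots; their frozen vectors differ, so
  \<open>u\<close> must be arbitrary.\<close>

lemma multilinear_diagonal_eq_binary_form:
  fixes A :: "(nat \<Rightarrow> real ^ 2) \<Rightarrow> real ^ 2"
  assumes lin: "\<And>x i. x \<in> {..<k} \<rightarrow>\<^sub>E UNIV \<Longrightarrow> i < k \<Longrightarrow> linear (\<lambda>v. A (x(i := v)))"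
    and "j \<le> k"
  shows "\<exists>c. \<forall>x. A (\<lambda>i\<in>{..<k}. if i < j then x else u i) = binary_form j c x"
  using \<open>j \<le> k\<close>
proof (induction j arbitrary: u)
  case 0
  show ?case by (rule exI[of _ "\<lambda>_. A (\<lambda>i\<in>{..<k}. u i)"]) (simp add: binary_form_def restrict_def)
next
  case (Suc j)
  define w where "w u x = (\<lambda>i\<in>{..<k}. if i < j then x else u i)" for u :: "nat \<Rightarrow> real ^ 2" and x
  obtain c where c: "\<And>x. A (w (u(j := axis 1 1)) x) = binary_form j c x"
    using Suc.IH[OF Suc_leD[OF Suc.prems], of "u(j := axis 1 1)"] unfolding w_def by blast
  obtain d where d: "\<And>x. A (w (u(j := axis 2 1)) x) = binary_form j d x"
    using Suc.IH[OF Suc_leD[OF Suc.prems], of "u(j := axis 2 1)"] unfolding w_def by blast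
  have upd: "(w u x)(j := v) = w (u(j := v)) x" for v x
    using Suc.prems by (auto simp: w_def fun_eq_iff)
  have "A (\<lambda>i\<in>{..<k}. if i < Suc j then x else u i) = x $ 1 *\<^sub>R binary_form j c x + x $ 2 *\<^sub>R binary_form j d x"
    for x
  proof -
    have l: "linear (\<lambda>v. A ((w u x)(j := v)))"
      using Suc.prems by (intro lin) (auto simp: w_def)
    have x: "x = (x $ 1) *\<^sub>R axis 1 1 + (x $ 2) *\<^sub>R axis 2 1"
      by (simp add: vec_eq_iff forall_2 axis_def)
    have "A (\<lambda>i\<in>{..<k}. if i < Suc j then x else u i) = A ((w u x)(j := x))"
      using Suc.prems by (intro arg_cong[of _ _ A]) (auto simp: w_def fun_eq_iff)
    also have "\<dots> = A ((w u x)(j := (x $ 1) *\<^sub>R axis 1 1 + (x $ 2) *\<^sub>R axis 2 1))"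
      using x by simp
    also have "\<dots> = x $ 1 *\<^sub>R A ((w u x)(j := axis 1 1)) + x $ 2 *\<^sub>R A ((w u x)(j := axis 2 1))"
      by (simp only: linear_add[OF l] linear_scale[OF l])
    finally show ?thesis by (simp only: upd c d)
  qed
  then show ?case using binary_form_Suc[of j c d] by (simp only:)
qed

lemma homogeneous_polynomial_binary_form:
  assumes "P \<in> homogeneous_polynomials N k"
  obtains c where "P = binary_form k c"
proof -
  obtain A where A: "continuous_multilinear N k A" "\<And>x. P x = A (\<lambda>i\<in>{..<k}. x)"
    using assms by (auto simp: homogeneous_polynomials_def)
  obtain c where "\<And>x. A (\<lambda>i\<in>{..<k}. if i < k then x else 0) = binary_form k c x"
    using multilinear_diagonal_eq_binary_form[of k A k "\<lambda>_. 0"] A(1)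
    by (auto simp: continuous_multilinear_def)
  moreover have "(\<lambda>i\<in>{..<k}. if i < k then x else 0) = (\<lambda>i\<in>{..<k}. x)" for x :: "real ^ 2"
    by auto
  ultimately have "P = binary_form k c" using A(2) by auto
  then show thesis by (rule that)
qed

section \<open>Forms of numerical radius zero\<close>

lemma binary_form_scale: "binary_form k c (a *\<^sub>R x) = a ^ k *\<^sub>R binary_form k c x"
proof -
  have "(a * x $ 1) ^ (k - i) * (a * x $ 2) ^ i = a ^ k * (x $ 1 ^ (k - i) * x $ 2 ^ i)" if "i \<le> k" for i
    using that by (simp add: power_mult_distrib mult_ac power_add[symmetric])
  then show ?thesis by (simp add: binary_form_def scaleR_sum_right)
qed

lemma support_functional_scale:
  "a > 0 \<Longrightarrow> support_functional p (a *\<^sub>R x) y = a powr (p - 1) * support_functional p x y"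
  by (simp add: support_functional_def sgn_mult abs_mult powr_mult algebra_simps)

text \<open>Testing at the normalized points (1, t) is enough: a nonzero second component would make
  \<open>p - 1\<close> an odd integer at most \<open>k\<close>, which \<open>not\<close>
  excludes.\<close>

lemma binary_form_kernel:
  fixes k :: nat and c :: "nat \<Rightarrow> real ^ 2"
  assumes p: "1 < p" and not: "\<not> (even_number p \<and> p - 1 \<le> real k)"
    and zero: "\<And>x. lp_norm p x = 1 \<Longrightarrow> support_functional p x (binary_form k c x) = 0"
    and "i \<le> k"
  shows "c i = 0"
proof -
  \<comment> \<open>The components of the form restricted to the line of points (1, t); they carry
    all coefficients.\<close>
  define q where "q j = (\<Sum>i\<le>k. monom (c i $ j) i)" for j
  have coeff_q: "coeff (q j) i = c i $ j" if "i \<le> k" for i j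
    using that by (simp add: q_def coeff_sum)
  have degree_q: "degree (q j) \<le> k" for j
    unfolding q_def by (intro degree_sum_le order_trans[OF degree_monom_le]) auto
  have q: "binary_form k c (vector [1, t]) $ j = poly (q j) t" for t j
    by (simp add: binary_form_nth q_def poly_sum poly_monom mult_ac)
  \<comment> \<open>Normalizing (1, t) multiplies the pairing by a positive factor only, so its
    vanishing carries over.\<close>
  have zero': "poly (q 1) t + sgn t * \<bar>t\<bar> powr (p - 1) * poly (q 2) t = 0" for t
  proof -
    define x :: "real ^ 2" where "x = vector [1, t]"
    define a where "a = inverse (lp_norm p x)"
    have "x \<noteq> 0" by (auto simp: x_def vec_eq_iff forall_2)
    then have "a > 0" and "lp_norm p (a *\<^sub>R x) = 1"
      using lp_norm_nonneg[OF p, of x] lp_norm_eq_0_iff[OF p, of x] lp_norm_normalize[OF p, of x]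
      by (auto simp: a_def)
    from zero[OF this(2)] have "support_functional p x (binary_form k c x) = 0"
      using \<open>a > 0\<close>
      by (simp add: support_functional_scale binary_form_scale linear_scale[OF linear_support_functional[OF p]])
    then show ?thesis
      unfolding support_functional_def x_def by (simp add: q)
  qed
  have pos: "poly (q 1) t = - (t powr (p - 1) * poly (q 2) t)" if "t > 0" for t
    using zero'[of t] that by simp
  have neg: "poly (q 1) (- t) = t powr (p - 1) * poly (q 2) (- t)" if "t > 0" for t
    using zero'[of "- t"] that by simp
  have "q 2 = 0"
  proof (rule ccontr)
    assume "q 2 \<noteq> 0"
    then obtain m where m: "p - 1 = real m" "odd m" "m \<le> degree (q 1)"
      using powr_polynomial_relation[OF _ _ pos neg] p by auto
    have "even_number p"
      unfolding even_number_def using m by (intro exI[of _ "int m + 1"]) auto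
    then show False using not m degree_q[of 1] by simp
  qed
  moreover have "q 1 = 0"
    by (rule poly_eq_if_eq_on_pos) (simp add: pos \<open>q 2 = 0\<close>)
  ultimately show ?thesis
    using coeff_q[OF \<open>i \<le> k\<close>, of 1] coeff_q[OF \<open>i \<le> k\<close>, of 2] by (simp add: vec_eq_iff forall_2)
qed

section \<open>A uniform lower bound by compactness\<close>

text \<open>All monomials are at most 1 in modulus on the unit ball. Consequently a form of norm one
  has coefficient norms summing to at least 1.\<close>

lemma lp_norm_binary_form_le:
  assumes p: "1 < p" and x: "x \<in> unit_ball (lp_norm p)"
  shows "lp_norm p (binary_form k c x) \<le> (\<Sum>i\<le>k. lp_norm p (c i))"
proof -
  have "\<bar>x $ j\<bar> \<le> 1" for j
    using component_le_lp_norm[OF p, of x j] x by (simp add: unit_ball_def)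
  then have "\<bar>x $ 1 ^ (k - i) * x $ 2 ^ i\<bar> \<le> 1" for i
    by (simp add: abs_mult power_abs mult_le_one power_le_one)
  then have "lp_norm p ((x $ 1 ^ (k - i) * x $ 2 ^ i) *\<^sub>R c i) \<le> lp_norm p (c i)" for i
    using lp_norm_nonneg[OF p, of "c i"] by (simp only: lp_norm_scale[OF p] mult_left_le_one_le abs_ge_zero)
  then have "(\<Sum>i\<le>k. lp_norm p ((x $ 1 ^ (k - i) * x $ 2 ^ i) *\<^sub>R c i)) \<le> (\<Sum>i\<le>k. lp_norm p (c i))"
    by (rule sum_mono)
  then show ?thesis
    using lp_norm_sum[OF p, of "\<lambda>i. (x $ 1 ^ (k - i) * x $ 2 ^ i) *\<^sub>R c i" "{..k}"]
    by (simp add: binary_form_def)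
qed

text \<open>A closed subset of a product of compact sets: unit balls up to index \<open>k\<close>,
  and {0} beyond, which pins down the irrelevant coefficients.\<close>

lemma compact_coefficient_sphere:
  fixes k :: nat
  assumes p: "1 < p"
  shows "compact {c. (\<Sum>i\<le>k. lp_norm p (c i)) = 1 \<and> (\<forall>i>k. c i = 0)}" (is "compact ?K")
proof -
  define S where "S i = (if i \<le> k then unit_ball (lp_norm p) else {0})" for i
  have "compactin (product_topology (\<lambda>_. euclidean) UNIV) (PiE UNIV S)"
    by (auto simp: compactin_PiE S_def compact_unit_ball[OF p])
  then have "compact (PiE UNIV S)" by (simp add: euclidean_product_topology)
  moreover have "closed {c. (\<Sum>i\<le>k. lp_norm p (c i)) = 1}"
    by (intro closed_Collect_eq continuous_intros
        continuous_on_compose2[OF continuous_on_lp_norm[OF p, of UNIV]]) auto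
  moreover have "?K = {c. (\<Sum>i\<le>k. lp_norm p (c i)) = 1} \<inter> PiE UNIV S"
  proof -
    have "c i \<in> S i" if "c \<in> ?K" for c i
    proof (cases "i \<le> k")
      case True
      then have "lp_norm p (c i) \<le> (\<Sum>i\<le>k. lp_norm p (c i))"
        by (intro member_le_sum) (auto simp: lp_norm_nonneg[OF p])
      then show ?thesis using that True by (simp add: S_def unit_ball_def)
    qed (use that in \<open>simp add: S_def\<close>)
    moreover have "c i = 0" if "c \<in> PiE UNIV S" "k < i" for c i
      using that by (auto simp: S_def PiE_iff dest: spec[of _ i])
    ultimately show ?thesis by (auto simp: PiE_iff)
  qed
  ultimately show ?thesis by (simp add: closed_Int_compact)
qed

lemma support_functional_lower_bound:
  assumes p: "1 < p" and not: "\<not> (even_number p \<and> p - 1 \<le> real k)"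
  obtains \<delta> where "\<delta> > 0"
    "\<And>c. 1 \<le> (\<Sum>i\<le>k. lp_norm p (c i)) \<Longrightarrow>
      \<exists>x. lp_norm p x = 1 \<and> \<delta> < \<bar>support_functional p x (binary_form k c x)\<bar>"
proof -
  let ?K = "{c. (\<Sum>i\<le>k. lp_norm p (c i)) = 1 \<and> (\<forall>i>k. c i = 0)}"
  let ?L = "\<lambda>x c. support_functional p x (binary_form k c x)"
  \<comment> \<open>For fixed \<open>x\<close> the pairing is continuous in \<open>c\<close>, so
    these sets are open; they increase with \<open>n\<close>, and trivial kernel makes them cover
    the sphere.\<close>
  define U where "U n = (\<Union>x\<in>{x. lp_norm p x = 1}. {c. 1 / real (Suc n) < \<bar>?L x c\<bar>})" for n
  have "open (U n)" for n
    unfolding U_def support_functional_def binary_form_nth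
    by (intro open_UN ballI open_Collect_less continuous_intros) auto
  moreover have "?K \<subseteq> (\<Union>n. U n)"
  proof
    fix c assume c: "c \<in> ?K"
    have "\<exists>x. lp_norm p x = 1 \<and> ?L x c \<noteq> 0"
    proof (rule ccontr)
      assume "\<not> ?thesis"
      then have "c i = 0" if "i \<le> k" for i
        using binary_form_kernel[OF p not, of c i] that by blast
      then show False using c lp_norm_eq_0_iff[OF p, of 0] by simp
    qed
    then obtain x where x: "lp_norm p x = 1" "?L x c \<noteq> 0" by blast
    then obtain n where "1 / real (Suc n) < \<bar>?L x c\<bar>"
      using reals_Archimedean[of "\<bar>?L x c\<bar>"] by (auto simp: inverse_eq_divide)
    then show "c \<in> (\<Union>n. U n)" using x(1) by (auto simp: U_def)
  qed
  ultimately obtain F where F: "finite F" "?K \<subseteq> (\<Union>n\<in>F. U n)"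
    using compactE_image[OF compact_coefficient_sphere[OF p], of UNIV U k] by auto
  \<comment> \<open>Inserting 0 keeps the maximum meaningful when \<open>F\<close> is empty.\<close>
  define M where "M = Max (insert 0 F)"
  have bound: "\<exists>x. lp_norm p x = 1 \<and> 1 / real (Suc M) < \<bar>?L x c\<bar>" if c: "c \<in> ?K" for c
  proof -
    obtain n x where n: "n \<in> F" "lp_norm p x = 1" "1 / real (Suc n) < \<bar>?L x c\<bar>"
      using F(2) c unfolding U_def by blast
    have "n \<le> M" using n(1) F(1) by (simp add: M_def)
    then have "1 / real (Suc M) \<le> 1 / real (Suc n)" by (simp add: field_simps)
    then show ?thesis using n by force
  qed
  have "\<exists>x. lp_norm p x = 1 \<and> 1 / real (Suc M) < \<bar>?L x c\<bar>"
    if "1 \<le> (\<Sum>i\<le>k. lp_norm p (c i))" for c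
  proof -
    define s where "s = (\<Sum>i\<le>k. lp_norm p (c i))"
    \<comment> \<open>Rescaling \<open>c\<close> to the sphere divides the pairing by
      \<open>s\<close>; since \<open>s\<close> is at least 1, the bound for \<open>d\<close> passes
      to \<open>c\<close>.\<close>
    define d where "d i = (if i \<le> k then inverse s *\<^sub>R c i else 0)" for i
    have "1 \<le> s" using that by (simp add: s_def)
    have "(\<Sum>i\<le>k. lp_norm p (d i)) = inverse s * s"
      using \<open>1 \<le> s\<close> by (simp add: d_def lp_norm_scale[OF p] sum_distrib_left[symmetric] s_def[symmetric])
    then have "d \<in> ?K" using \<open>1 \<le> s\<close> by (simp add: d_def)
    then obtain x where x: "lp_norm p x = 1" "1 / real (Suc M) < \<bar>?L x d\<bar>" using bound by blast
    have "binary_form k d x = inverse s *\<^sub>R binary_form k c x"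
      by (simp add: binary_form_def d_def scaleR_sum_right mult_ac)
    then have "\<bar>?L x d\<bar> = inverse s * \<bar>?L x c\<bar>"
      using \<open>1 \<le> s\<close> by (simp add: linear_scale[OF linear_support_functional[OF p]] abs_mult)
    also have "\<dots> \<le> \<bar>?L x c\<bar>" using \<open>1 \<le> s\<close> by (simp add: mult_left_le_one_le inverse_le_1_iff)
    finally show ?thesis using x by force
  qed
  then show thesis by (intro that[of "1 / real (Suc M)"]) auto
qed

section \<open>The polynomial numerical index\<close>

text \<open>Ensures that the real supremum defining the numerical radius is an upper bound for each
  of its values.\<close>

lemma bdd_above_numerical_values:
  assumes p: "1 < p" and P: "P \<in> homogeneous_polynomials (lp_norm p) k"
  shows "bdd_above ((\<lambda>(x, f). \<bar>f (P x)\<bar>) ` state_pairs (lp_norm p))"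
proof -
  obtain c where c: "P = binary_form k c" using P by (rule homogeneous_polynomial_binary_form)
  have "\<bar>f (P x)\<bar> \<le> (\<Sum>i\<le>k. lp_norm p (c i))" if "(x, f) \<in> state_pairs (lp_norm p)" for x f
  proof -
    have "x \<in> unit_ball (lp_norm p)" using that by (auto simp: state_pairs_def unit_sphere_def unit_ball_def)
    then show ?thesis
      using state_pair_bound[OF p that, of "P x"] lp_norm_binary_form_le[OF p, of x k c] c by force
  qed
  then show ?thesis by (intro bdd_aboveI) auto
qed

lemma support_functional_le_numerical_radius:
  assumes p: "1 < p" and P: "P \<in> homogeneous_polynomials (lp_norm p) k" and x: "lp_norm p x = 1"
  shows "\<bar>support_functional p x (P x)\<bar> \<le> numerical_radius (lp_norm p) P"
  unfolding numerical_radius_def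
  using cSUP_upper[OF support_functional_state_pair[OF p x] bdd_above_numerical_values[OF p P]] by simp

lemma lp_norm_axis: "1 < p \<Longrightarrow> lp_norm p (axis i 1) = 1"
  using exhaust_2[of i] by (auto simp: lp_norm_def axis_def)

lemma numerical_radius_nonneg:
  assumes "1 < p" "P \<in> homogeneous_polynomials (lp_norm p) k"
  shows "0 \<le> numerical_radius (lp_norm p) P"
  using support_functional_le_numerical_radius[OF assms lp_norm_axis[OF assms(1), of 1]] by linarith

section \<open>Monomial maps of norm one\<close>

text \<open>Writing monomials as products over \<open>k\<close> slots exhibits the multilinear map
  directly: slot \<open>j\<close> contributes its coordinate \<open>s j\<close> or
  \<open>t j\<close>.\<close>

lemma monomial_map_homogeneous_polynomial:
  fixes s t :: "nat \<Rightarrow> 2"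
  assumes p: "1 < p"
  shows "(\<lambda>x. vector [a * (\<Prod>j<k. x $ s j), b * (\<Prod>j<k. x $ t j)]) \<in> homogeneous_polynomials (lp_norm p) k"
proof -
  define A :: "(nat \<Rightarrow> real ^ 2) \<Rightarrow> real ^ 2"
    where "A u = vector [a * (\<Prod>j<k. u j $ s j), b * (\<Prod>j<k. u j $ t j)]" for u
  have prod_upd: "(\<Prod>j<k. (u(i := v)) j $ r j) = v $ r i * (\<Prod>j\<in>{..<k} - {i}. u j $ r j)"
    if "i < k" for u :: "nat \<Rightarrow> real ^ 2" and v i and r :: "nat \<Rightarrow> 2"
    using that by (subst prod.remove[of _ i]) auto
  have "linear (\<lambda>v. A (u(i := v)))" if "i < k" for u i
    by (rule linearI) (simp_all add: A_def prod_upd[OF that] vec_eq_iff forall_2 algebra_simps del: fun_upd_apply)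
  moreover have "continuous_map (product_topology (\<lambda>_. euclidean) {..<k}) euclidean A"
  proof -
    have proj: "continuous_map (product_topology (\<lambda>_. euclidean) {..<k}) euclideanreal (\<lambda>u. u j $ r)"
      if "j < k" for j and r :: 2
    proof -
      have "continuous_map (product_topology (\<lambda>_. euclidean) {..<k}) euclideanreal ((\<lambda>v. v $ r) \<circ> (\<lambda>u. u j))"
        by (rule continuous_map_compose[OF continuous_map_product_projection])
           (use that in \<open>auto intro!: continuous_intros\<close>)
      then show ?thesis by (simp add: o_def)
    qed
    have "A = (\<lambda>u. (a * (\<Prod>j<k. u j $ s j)) *\<^sub>R axis 1 1 + (b * (\<Prod>j<k. u j $ t j)) *\<^sub>R axis 2 1)"
      by (auto simp: A_def fun_eq_iff vec_eq_iff forall_2 axis_def)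
    moreover have "continuous_map (product_topology (\<lambda>_. euclidean) {..<k}) euclidean
        (\<lambda>u. (d * (\<Prod>j<k. u j $ r j)) *\<^sub>R e)" for d and r :: "nat \<Rightarrow> 2" and e :: "real ^ 2"
    proof -
      have "continuous_map (product_topology (\<lambda>_. euclidean) {..<k}) euclidean
          ((\<lambda>y. y *\<^sub>R e) \<circ> (\<lambda>u. d * (\<Prod>j<k. u j $ r j)))"
        by (intro continuous_map_compose[where X' = euclideanreal] continuous_map_real_mult
            continuous_map_prod proj) (auto intro!: continuous_intros)
      then show ?thesis by (simp add: o_def)
    qed
    ultimately show ?thesis by (simp add: continuous_map_add)
  qed
  ultimately show ?thesis
    unfolding homogeneous_polynomials_def continuous_multilinear_def norm_topology_lp_norm[OF p]
    by (auto intro!: exI[of _ A] simp: A_def)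
qed

text \<open>Since \<open>t\<close> always picks the first coordinate, the unscaled map is nonzero at
  (1, 0). Its maximum \<open>M\<close> over the compact ball is therefore positive, and
  \<open>inverse M\<close> serves as \<open>a\<close>.\<close>

lemma exists_normalized_monomial_map:
  fixes s t :: "nat \<Rightarrow> 2"
  assumes p: "1 < p" and t: "\<And>j. t j = 1"
  obtains a where "polynomial_norm (lp_norm p) (\<lambda>x. vector [- a * (\<Prod>j<k. x $ s j), a * (\<Prod>j<k. x $ t j)]) = 1"
proof -
  define P :: "real ^ 2 \<Rightarrow> real ^ 2"
    where "P x = (- (\<Prod>j<k. x $ s j)) *\<^sub>R axis 1 1 + (\<Prod>j<k. x $ t j) *\<^sub>R axis 2 1" for x
  have "continuous_on (unit_ball (lp_norm p)) (\<lambda>x. lp_norm p (P x))"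
    unfolding P_def
    by (intro continuous_on_compose2[OF continuous_on_lp_norm[OF p, of UNIV]] continuous_intros) auto
  moreover have e: "axis 1 1 \<in> unit_ball (lp_norm p)" by (simp add: unit_ball_def lp_norm_axis[OF p])
  ultimately obtain z where z: "z \<in> unit_ball (lp_norm p)"
    "\<And>x. x \<in> unit_ball (lp_norm p) \<Longrightarrow> lp_norm p (P x) \<le> lp_norm p (P z)"
    using continuous_attains_sup[OF compact_unit_ball[OF p]] by blast
  define M where "M = lp_norm p (P z)"
  have "P (axis 1 1) $ 2 = 1" by (simp add: P_def t axis_def)
  then have "M > 0"
    using z(2)[OF e] component_le_lp_norm[OF p, of "P (axis 1 1)" 2] by (simp add: M_def)
  have eq: "lp_norm p (vector [- inverse M * (\<Prod>j<k. x $ s j), inverse M * (\<Prod>j<k. x $ t j)]) =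
      inverse M * lp_norm p (P x)" for x
  proof -
    have "vector [- inverse M * (\<Prod>j<k. x $ s j), inverse M * (\<Prod>j<k. x $ t j)] = inverse M *\<^sub>R P x"
      by (simp add: vec_eq_iff forall_2 P_def axis_def)
    then show ?thesis using \<open>M > 0\<close> by (simp add: lp_norm_scale[OF p])
  qed
  have "polynomial_norm (lp_norm p)
      (\<lambda>x. vector [- inverse M * (\<Prod>j<k. x $ s j), inverse M * (\<Prod>j<k. x $ t j)]) = 1"
    unfolding polynomial_norm_def eq
  proof (rule cSup_eq_maximum)
    show "1 \<in> (\<lambda>x. inverse M * lp_norm p (P x)) ` unit_ball (lp_norm p)"
      using z(1) \<open>M > 0\<close> by (intro image_eqI[of _ _ z]) (auto simp: M_def)
    show "y \<le> 1" if "y \<in> (\<lambda>x. inverse M * lp_norm p (P x)) ` unit_ball (lp_norm p)" for y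
      using that z(2) \<open>M > 0\<close> by (auto simp: M_def field_simps)
  qed
  then show thesis by (rule that)
qed

lemma polynomial_numerical_index_pos:
  assumes p: "1 < p" and not: "\<not> (even_number p \<and> p - 1 \<le> real k)"
  shows "polynomial_numerical_index (lp_norm p) k > 0"
proof -
  let ?H = "{P \<in> homogeneous_polynomials (lp_norm p) k. polynomial_norm (lp_norm p) P = 1}"
  obtain \<delta> where \<delta>: "\<delta> > 0" "\<And>c. 1 \<le> (\<Sum>i\<le>k. lp_norm p (c i)) \<Longrightarrow>
      \<exists>x. lp_norm p x = 1 \<and> \<delta> < \<bar>support_functional p x (binary_form k c x)\<bar>"
    using support_functional_lower_bound[OF p not] by blast
  obtain a where "polynomial_norm (lp_norm p)
      (\<lambda>x. vector [- a * (\<Prod>j<k. x $ (\<lambda>_. 1) j), a * (\<Prod>j<k. x $ (\<lambda>_. 1) j)]) = 1"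
    using exists_normalized_monomial_map[OF p, where s = "\<lambda>_. 1" and t = "\<lambda>_. 1" and k = k] by blast
  \<comment> \<open>A real infimum inherits a lower bound only from a nonempty set.\<close>
  then have "?H \<noteq> {}" using monomial_map_homogeneous_polynomial[OF p, where a = "- a" and b = a and s = "\<lambda>_. 1" and t = "\<lambda>_. 1" and k = k] by blast
  moreover have "\<delta> \<le> numerical_radius (lp_norm p) P" if P: "P \<in> ?H" for P
  proof -
    obtain c where c: "P = binary_form k c"
      using P homogeneous_polynomial_binary_form[of P "lp_norm p" k] by blast
    have "polynomial_norm (lp_norm p) P \<le> (\<Sum>i\<le>k. lp_norm p (c i))"
      unfolding polynomial_norm_def c
    proof (rule cSUP_least)
      show "unit_ball (lp_norm p) \<noteq> {}" using lp_norm_axis[OF p, of 1] by (auto simp: unit_ball_def intro!: exI[of _ "axis 1 1"])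
    qed (rule lp_norm_binary_form_le[OF p])
    then obtain x where "lp_norm p x = 1" "\<delta> < \<bar>support_functional p x (P x)\<bar>"
      using \<delta>(2)[of c] P c by auto
    then show ?thesis using support_functional_le_numerical_radius[OF p, of P k x] P by force
  qed
  ultimately have "\<delta> \<le> polynomial_numerical_index (lp_norm p) k"
    unfolding polynomial_numerical_index_def by (intro cINF_greatest)
  then show ?thesis using \<delta>(1) by linarith
qed

section \<open>Vanishing index for even exponents\<close>

text \<open>
  \<open>r \<mapsto> N (x + r y)\<^sup>n - f (x + r y)\<^sup>n\<close> is a nonnegative polynomial vanishing at \<open>r = 0\<close>, so its
  derivative there vanishes, which determines \<open>f\<close>.
\<close>

lemma state_pair_even:
  fixes n :: nat
  assumes n: "even n" "1 < n" and xf: "(x, f) \<in> state_pairs (lp_norm (real n))"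
  shows "f y = x $ 1 ^ (n - 1) * y $ 1 + x $ 2 ^ (n - 1) * y $ 2"
proof -
  have p: "1 < real n" using n by simp
  have f: "linear f" "f x = 1" "lp_norm (real n) x = 1"
    using xf by (auto simp: state_pairs_def dual_unit_sphere_def unit_sphere_def dual_space_lp_norm[OF p])
  \<comment> \<open>Evenness removes the absolute values and makes \<open>h\<close> a polynomial in
    \<open>r\<close>.\<close>
  have norm: "lp_norm (real n) z ^ n = z $ 1 ^ n + z $ 2 ^ n" for z
    using lp_norm_powr[OF p, of z] n lp_norm_nonneg[OF p, of z]
    by (simp add: powr_realpow' power_even_abs)
  define h where "h r = (x $ 1 + r * y $ 1) ^ n + (x $ 2 + r * y $ 2) ^ n - (1 + r * f y) ^ n" for r
  have "h 0 = 0" using norm[of x] f by (simp add: h_def)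
  moreover have "0 \<le> h r" for r
  proof -
    have "1 + r * f y = f (x + r *\<^sub>R y)"
      by (simp add: linear_add[OF f(1)] linear_scale[OF f(1)] f(2))
    then have "(1 + r * f y) ^ n \<le> lp_norm (real n) (x + r *\<^sub>R y) ^ n"
      using power_mono[OF state_pair_bound[OF p xf, of "x + r *\<^sub>R y"], of n] n by (simp add: power_even_abs)
    then show ?thesis by (simp add: h_def norm)
  qed
  moreover have "(h has_real_derivative
      real n * (x $ 1 ^ (n - 1) * y $ 1 + x $ 2 ^ (n - 1) * y $ 2 - f y)) (at 0)"
    unfolding h_def by (auto intro!: derivative_eq_intros simp: algebra_simps)
  ultimately have "real n * (x $ 1 ^ (n - 1) * y $ 1 + x $ 2 ^ (n - 1) * y $ 2 - f y) = 0"
    by (intro DERIV_local_min[of h _ 0 1]) auto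
  then show ?thesis using n by simp
qed

text \<open>Pairing the witness with the functional from \<open>state_pair_even\<close> gives two
  equal monomials of opposite sign. The condition on \<open>k\<close> leaves room for the factor of
  degree \<open>n - 1\<close>.\<close>

lemma polynomial_numerical_index_eq_0:
  assumes n: "even n" "1 < n" and k: "n - 1 \<le> k"
  shows "polynomial_numerical_index (lp_norm (real n)) k = 0"
proof -
  have p: "1 < real n" using n by simp
  let ?N = "lp_norm (real n)"
  \<comment> \<open>The first \<open>n - 1\<close> slots read the second coordinate, the others the
    first.\<close>
  define s :: "nat \<Rightarrow> 2" where "s j = (if j < n - 1 then 2 else 1)" for j
  obtain a where a: "polynomial_norm ?N (\<lambda>x. vector [- a * (\<Prod>j<k. x $ s j), a * (\<Prod>j<k. x $ (\<lambda>_. 1) j)]) = 1"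
    using exists_normalized_monomial_map[OF p, where s = s and t = "\<lambda>_. 1" and k = k] by blast
  define P :: "real ^ 2 \<Rightarrow> real ^ 2"
    where "P x = vector [- a * (\<Prod>j<k. x $ s j), a * (\<Prod>j<k. x $ (\<lambda>_. 1) j)]" for x
  have P: "P \<in> homogeneous_polynomials ?N k" "polynomial_norm ?N P = 1"
    using monomial_map_homogeneous_polynomial[OF p, where a = "- a" and b = a and s = s and t = "\<lambda>_. 1" and k = k] a
    unfolding P_def[abs_def] by auto
  have prod_s: "(\<Prod>j<k. x $ s j) = x $ 2 ^ (n - 1) * x $ 1 ^ (k - (n - 1))" for x :: "real ^ 2"
  proof -
    have "{..<k} = {..<n - 1} \<union> {n - 1..<k}" using k by auto
    then have "(\<Prod>j<k. x $ s j) = (\<Prod>j<n - 1. x $ s j) * (\<Prod>j\<in>{n - 1..<k}. x $ s j)"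
      by (simp add: prod.union_disjoint ivl_disj_int)
    then show ?thesis by (simp add: s_def)
  qed
  have "f (P x) = 0" if "(x, f) \<in> state_pairs ?N" for x f
  proof -
    have "x $ 1 ^ k = x $ 1 ^ (n - 1) * x $ 1 ^ (k - (n - 1))" using k by (simp flip: power_add)
    then show ?thesis by (simp add: state_pair_even[OF n that] P_def prod_s)
  qed
  \<comment> \<open>Besides the vanishing values, the existence of a state pair is needed for the
    image to be {0} rather than empty.\<close>
  then have "(\<lambda>(x, f). \<bar>f (P x)\<bar>) ` state_pairs ?N = {0}"
    using support_functional_state_pair[OF p lp_norm_axis[OF p, of 1]] by (force simp: image_iff)
  then have v: "numerical_radius ?N P = 0" by (simp add: numerical_radius_def)
  have "polynomial_numerical_index ?N k = (INF P\<in>{P \<in> homogeneous_polynomials ?N k. polynomial_norm ?N P = 1}. numerical_radius ?N P)"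
    by (rule polynomial_numerical_index_def)
  also have "\<dots> = 0"
  proof (rule cInf_eq_minimum)
    show "0 \<in> numerical_radius ?N ` {P \<in> homogeneous_polynomials ?N k. polynomial_norm ?N P = 1}"
      using P v by (intro image_eqI[of _ _ P]) auto
  qed (use numerical_radius_nonneg[OF p] in auto)
  finally show ?thesis .
qed

theorem mainTheorem1:
  fixes p :: real
  assumes "1 < p"
  shows "(even_number p \<longrightarrow>
           (\<forall>k::nat. k \<ge> 1 \<longrightarrow>
              (real k \<ge> p - 1 \<longrightarrow> polynomial_numerical_index (lp_norm p) k = 0) \<and>
              (real k < p - 1 \<longrightarrow> polynomial_numerical_index (lp_norm p) k > 0))) \<and>
         (\<not> even_number p \<longrightarrow>
           (\<forall>k::nat. k \<ge> 1 \<longrightarrow> polynomial_numerical_index (lp_norm p) k > 0))"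
proof -
  have "polynomial_numerical_index (lp_norm p) k = 0" if even: "even_number p" and k: "real k \<ge> p - 1" for k
  proof -
    obtain m :: int where m: "even m" "p = of_int m" using even by (auto simp: even_number_def)
    define n where "n = nat m"
    have n: "p = real n" "even n" "1 < n" using m assms by (auto simp: n_def even_nat_iff)
    show ?thesis
      using polynomial_numerical_index_eq_0[OF n(2,3), of k] n k by simp
  qed
  then show ?thesis using polynomial_numerical_index_pos[OF assms] by auto
qed

end
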